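(* Let $S_7$ be the ai-semiring on $\{0,a,1\}$ defined in the context, and let $(S_7,\cdot)$ be its multiplicative reduct. Then $S_7\in\mathsf{V}(\mathcal{P}^+(S_7,\cdot))$.
   Context: An ai-semiring is an algebra $(S,+,\cdot)$ with $(S,+)$ a commutative idempotent semigroup, $(S,\cdot)$ a semigroup, and multiplication distributing over addition on both sides. No constants are in the signature. $S_7$ is the ai-semiring on $\{0,a,1\}$ in which $x+x=x$ and $x+y=0$ for all $x\ne y$, and in which multiplication is commutative with identity $1$, zero $0$ and $a\cdot a=0$. For a semigroup $S$, $\mathcal{P}^+(S)$ is the ai-semiring of all nonempty subsets of $S$ with $A+B=A\cup B$ and $AB=\{ab\mid a\in A,b\in B\}$. $\mathsf{V}(A)$ is the variety generated by $A$. *)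

theory Defs
  imports "HOL-Library.FuncSet"
begin

record 'a sgr =
  carrier :: "'a set"
  mul :: "'a \<Rightarrow> 'a \<Rightarrow> 'a"

record 'a sring = "'a sgr" +
  add :: "'a \<Rightarrow> 'a \<Rightarrow> 'a"

definition semigroup_on :: "('a, 'm) sgr_scheme \<Rightarrow> bool" where
  "semigroup_on G \<longleftrightarrow> carrier G \<noteq> {} \<and>
     (\<forall>x\<in>carrier G. \<forall>y\<in>carrier G. mul G x y \<in> carrier G) \<and>
     (\<forall>x\<in>carrier G. \<forall>y\<in>carrier G. \<forall>z\<in>carrier G. mul G (mul G x y) z = mul G x (mul G y z))"

definition ai_semiring :: "'a sring \<Rightarrow> bool" where
  "ai_semiring S \<longleftrightarrow> semigroup_on S \<and>
     (\<forall>x\<in>carrier S. \<forall>y\<in>carrier S. add S x y \<in> carrier S) \<and>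
     (\<forall>x\<in>carrier S. \<forall>y\<in>carrier S. \<forall>z\<in>carrier S. add S (add S x y) z = add S x (add S y z)) \<and>
     (\<forall>x\<in>carrier S. \<forall>y\<in>carrier S. add S x y = add S y x) \<and>
     (\<forall>x\<in>carrier S. add S x x = x) \<and>
     (\<forall>x\<in>carrier S. \<forall>y\<in>carrier S. \<forall>z\<in>carrier S.
        mul S x (add S y z) = add S (mul S x y) (mul S x z) \<and>
        mul S (add S x y) z = add S (mul S x z) (mul S y z))"

abbreviation mult_reduct :: "'a sring \<Rightarrow> 'a sgr" where
  "mult_reduct S \<equiv> sgr.truncate S"

datatype s7 = Zero | Elt_a | One

fun s7_mul :: "s7 \<Rightarrow> s7 \<Rightarrow> s7" where
  "s7_mul One y = y"
| "s7_mul x One = x"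
| "s7_mul _ _ = Zero"

definition S7 :: "s7 sring" where
  "S7 = \<lparr>carrier = UNIV, mul = s7_mul, add = (\<lambda>x y. if x = y then x else Zero)\<rparr>"

definition power_sring :: "'a sgr \<Rightarrow> 'a set sring" where
  "power_sring G =
     \<lparr>carrier = {X. X \<subseteq> carrier G \<and> X \<noteq> {}},
      mul = (\<lambda>X Y. {mul G a b | a b. a \<in> X \<and> b \<in> Y}),
      add = (\<union>)\<rparr>"

lemma ai_semiring_S7: "ai_semiring S7"
proof -
  have assoc: "s7_mul (s7_mul x y) z = s7_mul x (s7_mul y z)" for x y z
    by (cases x; cases y; cases z) simp_all
  have distrib: "s7_mul x (if y = z then y else Zero) =
      (if s7_mul x y = s7_mul x z then s7_mul x y else Zero)"
    "s7_mul (if x = y then x else Zero) z =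
      (if s7_mul x z = s7_mul y z then s7_mul x z else Zero)" for x y z
    by (cases x; cases y; cases z; simp)+
  show ?thesis
    unfolding ai_semiring_def semigroup_on_def S7_def
    by (simp add: assoc distrib)
qed

lemma ai_semiring_power_sring:
  assumes "semigroup_on G"
  shows "ai_semiring (power_sring G)"
proof -
  have mem: "mul G x y \<in> carrier G" if "x \<in> carrier G" "y \<in> carrier G" for x y
    using assms that by (simp add: semigroup_on_def)
  have assoc: "mul G (mul G x y) z = mul G x (mul G y z)"
    if "x \<in> carrier G" "y \<in> carrier G" "z \<in> carrier G" for x y z
    using assms that by (simp add: semigroup_on_def)
  let ?P = "power_sring G"
  have "mul ?P (mul ?P X Y) Z = mul ?P X (mul ?P Y Z)"
    if "X \<in> carrier ?P" "Y \<in> carrier ?P" "Z \<in> carrier ?P" for X Y Z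
  proof -
    have eq: "mul G (mul G x y) z = mul G x (mul G y z)" if "x \<in> X" "y \<in> Y" "z \<in> Z" for x y z
    proof (rule assoc)
      show "x \<in> carrier G" "y \<in> carrier G" "z \<in> carrier G"
        using that \<open>X \<in> _\<close> \<open>Y \<in> _\<close> \<open>Z \<in> _\<close> by (auto simp: power_sring_def)
    qed
    have "mul ?P (mul ?P X Y) Z = {mul G (mul G x y) z | x y z. x \<in> X \<and> y \<in> Y \<and> z \<in> Z}"
      by (simp add: power_sring_def) blast
    also have "\<dots> = {mul G x (mul G y z) | x y z. x \<in> X \<and> y \<in> Y \<and> z \<in> Z}"
      by (intro Collect_cong iff_exI) (auto simp: eq)
    also have "\<dots> = mul ?P X (mul ?P Y Z)"
      by (simp add: power_sring_def) blast
    finally show ?thesis .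
  qed
  moreover have "carrier ?P \<noteq> {}" using assms by (auto simp: power_sring_def semigroup_on_def)
  moreover have "mul ?P X Y \<in> carrier ?P" if "X \<in> carrier ?P" "Y \<in> carrier ?P" for X Y
    using that mem by (simp add: power_sring_def subset_iff) blast
  moreover have "mul ?P X (add ?P Y Z) = add ?P (mul ?P X Y) (mul ?P X Z)"
    "mul ?P (add ?P X Y) Z = add ?P (mul ?P X Z) (mul ?P Y Z)" for X Y Z
    by (simp add: power_sring_def; blast)+
  moreover have "add ?P = (\<union>)" by (simp add: power_sring_def)
  moreover have "X \<union> Y \<in> carrier ?P" if "X \<in> carrier ?P" "Y \<in> carrier ?P" for X Y
    using that by (auto simp: power_sring_def)
  ultimately show ?thesis
    unfolding ai_semiring_def semigroup_on_def by (simp add: Un_ac)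
qed

definition prod_sring :: "'i set \<Rightarrow> ('i \<Rightarrow> 'a sring) \<Rightarrow> ('i \<Rightarrow> 'a) sring" where
  "prod_sring I F =
     \<lparr>carrier = (\<Pi>\<^sub>E i\<in>I. carrier (F i)),
      mul = (\<lambda>x y. \<lambda>i\<in>I. mul (F i) (x i) (y i)),
      add = (\<lambda>x y. \<lambda>i\<in>I. add (F i) (x i) (y i))\<rparr>"

definition subalgebra :: "'a sring \<Rightarrow> 'a sring \<Rightarrow> bool" where
  "subalgebra C S \<longleftrightarrow> carrier C \<noteq> {} \<and> carrier C \<subseteq> carrier S \<and> mul C = mul S \<and> add C = add S \<and>
     (\<forall>x\<in>carrier C. \<forall>y\<in>carrier C. mul S x y \<in> carrier C \<and> add S x y \<in> carrier C)"

definition sring_hom :: "'a sring \<Rightarrow> 'b sring \<Rightarrow> ('a \<Rightarrow> 'b) set" where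
  "sring_hom S T = {h \<in> carrier S \<rightarrow> carrier T. \<forall>x\<in>carrier S. \<forall>y\<in>carrier S.
     h (mul S x y) = mul T (h x) (h y) \<and> h (add S x y) = add T (h x) (h y)}"

definition op_H :: "'a sring set \<Rightarrow> 'b sring set" where
  "op_H K = {T. \<exists>S\<in>K. \<exists>h\<in>sring_hom S T. h ` carrier S = carrier T}"

definition op_S :: "'a sring set \<Rightarrow> 'a sring set" where
  "op_S K = {C. \<exists>S\<in>K. subalgebra C S}"

definition op_P :: "'a sring set \<Rightarrow> ('i \<Rightarrow> 'a) sring set" where
  "op_P K = {prod_sring I F | I F. \<forall>i\<in>I. F i \<in> K}"

text \<open>
  The variety generated by \<open>S\<close> is \<open>HSP(S)\<close>. HOL has no quantification over types, so an index
  type for the products must be fixed: a member over the type \<open>'b\<close> is an image of a free algebra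
  generated by its elements, which embeds into a power of \<open>S\<close> indexed by maps from \<open>'b\<close> to the type
  of \<open>S\<close>. So no members are lost; \<open>variety_iff_identities\<close> below confirms this.
\<close>

definition variety :: "'a sring \<Rightarrow> 'b sring set" where
  "variety S = op_H (op_S (op_P {S} :: (('b \<Rightarrow> 'a) \<Rightarrow> 'a) sring set))"

datatype 'v trm = Var 'v | Mul "'v trm" "'v trm" | Add "'v trm" "'v trm"

fun eval :: "'a sring \<Rightarrow> ('v \<Rightarrow> 'a) \<Rightarrow> 'v trm \<Rightarrow> 'a" where
  "eval S f (Var v) = f v"
| "eval S f (Mul s t) = mul S (eval S f s) (eval S f t)"
| "eval S f (Add s t) = add S (eval S f s) (eval S f t)"

definition satisfies :: "'a sring \<Rightarrow> 'v trm \<Rightarrow> 'v trm \<Rightarrow> bool" where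
  "satisfies S s t \<longleftrightarrow> (\<forall>f. range f \<subseteq> carrier S \<longrightarrow> eval S f s = eval S f t)"

lemma eval_closed:
  assumes "ai_semiring S" "f ` set_trm t \<subseteq> carrier S"
  shows "eval S f t \<in> carrier S"
proof -
  have "mul S x y \<in> carrier S" "add S x y \<in> carrier S"
    if "x \<in> carrier S" "y \<in> carrier S" for x y
    using assms(1) that unfolding ai_semiring_def semigroup_on_def by blast+
  then show ?thesis using assms(2) by (induction t) (auto simp: image_Un)
qed

lemma eval_map: "eval S f (map_trm r t) = eval S (f \<circ> r) t"
  by (induction t) auto

lemma eval_cong: "(\<And>v. v \<in> set_trm t \<Longrightarrow> f v = g v) \<Longrightarrow> eval S f t = eval S g t"
  by (induction t) auto

lemma finite_set_trm: "finite (set_trm t)"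
  by (induction t) auto

lemma variety_imp_identities:
  fixes S :: "'a sring" and T :: "'b sring" and s t :: "'v trm"
  assumes "T \<in> variety S" "satisfies S s t"
  shows "satisfies T s t"
proof -
  obtain I F C h where F: "\<forall>i\<in>I. F i = S"
    and C: "subalgebra C (prod_sring (I :: ('b \<Rightarrow> 'a) set) F)"
    and h: "h \<in> sring_hom C T" "h ` carrier C = carrier T"
    using assms(1) unfolding variety_def op_H_def op_S_def op_P_def by auto
  show ?thesis
    unfolding satisfies_def
  proof (intro allI impI)
    fix f :: "'v \<Rightarrow> 'b" assume f: "range f \<subseteq> carrier T"
    define g where "g v = inv_into (carrier C) h (f v)" for v
    have g: "g v \<in> carrier C" "h (g v) = f v" for v
    proof -
      have "f v \<in> h ` carrier C" using f h(2) by auto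
      then show "g v \<in> carrier C" "h (g v) = f v"
        unfolding g_def by (rule inv_into_into, rule f_inv_into_f)
    qed
    have C_closed: "eval C g u \<in> carrier C" for u
      using C g by (induction u) (auto simp: subalgebra_def)
    have hom: "h (eval C g u) = eval T f u" for u
      using h(1) g C_closed by (induction u) (auto simp: sring_hom_def)
    have proj: "eval C g u i = eval S (\<lambda>v. g v i) u" if "i \<in> I" for u i
      using C F that by (induction u) (auto simp: subalgebra_def prod_sring_def)
    have gP: "g v \<in> (\<Pi>\<^sub>E i\<in>I. carrier S)" for v
      using g(1)[of v] C F by (auto simp: subalgebra_def prod_sring_def cong: PiE_cong)
    have evP: "eval C g u \<in> (\<Pi>\<^sub>E i\<in>I. carrier S)" for u
      using C_closed[of u] C F by (auto simp: subalgebra_def prod_sring_def cong: PiE_cong)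
    have "eval C g s i = eval C g t i" if "i \<in> I" for i
    proof -
      have "range (\<lambda>v. g v i) \<subseteq> carrier S" using gP PiE_mem that by fast
      then show ?thesis using assms(2) that by (simp add: proj satisfies_def)
    qed
    then have "eval C g s = eval C g t" by (rule PiE_ext[OF evP evP])
    then show "eval T f s = eval T f t" using hom[of s] hom[of t] by simp
  qed
qed

lemma identities_imp_variety:
  fixes S :: "'a sring" and T :: "'b sring"
  assumes S: "ai_semiring S" and T: "ai_semiring T"
    and id: "\<And>s t :: nat trm. satisfies S s t \<Longrightarrow> satisfies T s t"
  shows "T \<in> variety S"
proof -
  define I where "I = (carrier T \<rightarrow> carrier S)"
  define W where "W = {u :: 'b trm. set_trm u \<subseteq> carrier T}"
  define p where "p u = (\<lambda>f\<in>I. eval S f u)" for u :: "'b trm"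
  define P where "P = prod_sring I (\<lambda>_. S)"
  define C where "C = \<lparr>carrier = p ` W, mul = mul P, add = add P\<rparr>"
  have T_ne: "carrier T \<noteq> {}"
    using T by (auto simp: ai_semiring_def semigroup_on_def)
  have p_ops: "mul P (p u) (p v) = p (Mul u v)" "add P (p u) (p v) = p (Add u v)" for u v
    by (auto simp: p_def P_def prod_sring_def)
  have p_in: "p u \<in> carrier P" if "u \<in> W" for u
  proof -
    have "eval S f u \<in> carrier S" if "f \<in> I" for f
      using \<open>u \<in> W\<close> that by (intro eval_closed[OF S]) (auto simp: W_def I_def)
    then show ?thesis by (auto simp: p_def P_def prod_sring_def)
  qed
  have W_ops: "Mul u v \<in> W" "Add u v \<in> W" if "u \<in> W" "v \<in> W" for u v
    using that by (auto simp: W_def)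
  have sub: "subalgebra C P"
  proof -
    obtain c where "c \<in> carrier T" using T_ne by blast
    then have "Var c \<in> W" by (simp add: W_def)
    then have "W \<noteq> {}" by blast
    then show ?thesis
      unfolding subalgebra_def C_def using p_in W_ops by (auto simp: p_ops)
  qed
  have kernel: "eval T id s = eval T id t" if st: "s \<in> W" "t \<in> W" "p s = p t" for s t
  proof -
    let ?V = "set_trm s \<union> set_trm t"
    obtain r :: "'b \<Rightarrow> nat" where r: "inj_on r ?V"
      using finite_imp_inj_to_nat_seg[of ?V] finite_set_trm by (metis finite_UnI)
    have "satisfies S (map_trm r s) (map_trm r t)"
      unfolding satisfies_def
    proof (intro allI impI)
      fix f :: "nat \<Rightarrow> 'a" assume "range f \<subseteq> carrier S"
      then have "f \<circ> r \<in> I" by (auto simp: I_def)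
      then show "eval S f (map_trm r s) = eval S f (map_trm r t)"
        using fun_cong[OF st(3), of "f \<circ> r"] by (simp add: p_def eval_map)
    qed
    then have sat: "satisfies T (map_trm r s) (map_trm r t)" by (rule id)
    obtain c where c: "c \<in> carrier T" using T_ne by blast
    define f where "f n = (if n \<in> r ` ?V then inv_into ?V r n else c)" for n
    have "?V \<subseteq> carrier T" using st by (auto simp: W_def)
    then have "f n \<in> carrier T" for n
    proof (cases "n \<in> r ` ?V")
      case True
      then have "f n \<in> ?V" unfolding f_def by (simp only: if_True inv_into_into)
      then show ?thesis using \<open>?V \<subseteq> carrier T\<close> by blast
    next
      case False
      then show ?thesis unfolding f_def using c by (simp only: if_False)
    qed
    then have "range f \<subseteq> carrier T" by blast
    then have "eval T (f \<circ> r) s = eval T (f \<circ> r) t"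
      using sat by (simp add: satisfies_def eval_map)
    moreover have "f (r v) = v" if "v \<in> ?V" for v
      unfolding f_def using that inv_into_f_f[OF r that] by simp
    then have "eval T (f \<circ> r) s = eval T id s" "eval T (f \<circ> r) t = eval T id t"
      by (auto intro!: eval_cong)
    ultimately show ?thesis by simp
  qed
  define h where "h x = eval T id (inv_into W p x)" for x
  have h_p: "h (p u) = eval T id u" if "u \<in> W" for u
    unfolding h_def using that by (intro kernel) (auto simp: inv_into_into f_inv_into_f)
  have ev: "eval T id u \<in> carrier T" if "u \<in> W" for u
    using that by (intro eval_closed[OF T]) (auto simp: W_def)
  have hom: "h \<in> sring_hom C T"
    using ev W_ops by (auto simp: sring_hom_def C_def p_ops h_p)
  have "h ` carrier C = carrier T"
  proof
    show "h ` carrier C \<subseteq> carrier T" using hom by (auto simp: sring_hom_def)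
    show "carrier T \<subseteq> h ` carrier C"
    proof
      fix b assume "b \<in> carrier T"
      then have "Var b \<in> W" by (simp add: W_def)
      then show "b \<in> h ` carrier C" using h_p[of "Var b"] by (force simp: C_def)
    qed
  qed
  moreover have "P \<in> op_P {S}" by (auto simp: op_P_def P_def)
  then have "C \<in> op_S (op_P {S})" using sub by (auto simp: op_S_def)
  ultimately show ?thesis
    using hom unfolding variety_def op_H_def by blast
qed

theorem variety_iff_identities:
  assumes "ai_semiring S" "ai_semiring T"
  shows "T \<in> variety S \<longleftrightarrow> (\<forall>s t :: nat trm. satisfies S s t \<longrightarrow> satisfies T s t)"
  using assms variety_imp_identities identities_imp_variety by blast

end

(* Sending every singleton to its element and every larger subset to 0 is a homomorphism from the
   power semiring of the multiplicative reduct of S7 onto S7, since a product of nonempty subsets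
   is {1} or {a} only if both factors are singletons. *)
theory Submission
  imports Defs
begin

text \<open>Identities pass to surjective images, since choosing preimages under \<open>h\<close>
  lifts every valuation in \<open>T\<close> to one in \<open>S\<close>. Arguing through identities
  avoids building a product over the index type that \<open>variety\<close> prescribes.\<close>

lemma hom_image_in_variety:
  fixes S :: "'a sring" and T :: "'b sring"
  assumes S: "ai_semiring S" and T: "ai_semiring T"
    and h: "h \<in> sring_hom S T" "h ` carrier S = carrier T"
  shows "T \<in> variety S"
proof (rule identities_imp_variety[OF S T])
  fix s t :: "nat trm" assume sat: "satisfies S s t"
  show "satisfies T s t"
    unfolding satisfies_def
  proof (intro allI impI)
    fix f :: "nat \<Rightarrow> 'b" assume f: "range f \<subseteq> carrier T"
    define g where "g = inv_into (carrier S) h \<circ> f"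
    have "f v \<in> h ` carrier S" for v using f h(2) by auto
    then have g: "g v \<in> carrier S" "h (g v) = f v" for v
      by (simp_all add: g_def inv_into_into f_inv_into_f)
    have "eval S g u \<in> carrier S" for u
      using g by (intro eval_closed[OF S]) auto
    then have "h (eval S g u) = eval T f u" for u
      using h(1) g by (induction u) (auto simp: sring_hom_def)
    moreover have "eval S g s = eval S g t"
      using sat g by (auto simp: satisfies_def)
    ultimately show "eval T f s = eval T f t" by metis
  qed
qed

lemma semigroup_on_mult_reduct: "ai_semiring S \<Longrightarrow> semigroup_on (mult_reduct S)"
  by (simp add: ai_semiring_def semigroup_on_def sgr.defs)

text \<open>For nonempty \<open>X\<close> this is the sum in \<open>S7\<close> of all elements of
  \<open>X\<close>, because two distinct summands already give \<open>Zero\<close>.\<close>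

definition collapse :: "s7 set \<Rightarrow> s7" where
  "collapse X = (if X = {One} then One else if X = {Elt_a} then Elt_a else Zero)"

lemma s7_mul_eq_One: "s7_mul x y = One \<longleftrightarrow> x = One \<and> y = One"
  by (cases x; cases y) simp_all

lemma s7_mul_eq_Elt_a: "s7_mul x y = Elt_a \<longleftrightarrow> x = One \<and> y = Elt_a \<or> x = Elt_a \<and> y = One"
  by (cases x; cases y) simp_all

lemma eq_singleton_iff_ball: "Z \<noteq> {} \<Longrightarrow> Z = {c} \<longleftrightarrow> (\<forall>z\<in>Z. z = c)"
  by auto

text \<open>The value of \<open>collapse\<close> depends only on whether its argument is
  \<open>{One}\<close>, \<open>{Elt_a}\<close> or neither, so it suffices to find out which factors
  give these two product sets.\<close>

lemma collapse_mul:
  assumes "X \<noteq> {}" "Y \<noteq> {}"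
  shows "collapse {s7_mul x y | x y. x \<in> X \<and> y \<in> Y} = s7_mul (collapse X) (collapse Y)"
proof -
  let ?XY = "{s7_mul x y | x y. x \<in> X \<and> y \<in> Y}"
  obtain x y where xy: "x \<in> X" "y \<in> Y" using assms by blast
  then have "?XY \<noteq> {}" by blast
  then have ball: "?XY = {c} \<longleftrightarrow> (\<forall>x\<in>X. \<forall>y\<in>Y. s7_mul x y = c)" for c
    unfolding eq_singleton_iff_ball[OF \<open>?XY \<noteq> {}\<close>] by blast
  note balls = ball eq_singleton_iff_ball[OF assms(1)] eq_singleton_iff_ball[OF assms(2)]
  have "?XY = {One} \<longleftrightarrow> X = {One} \<and> Y = {One}"
    unfolding balls s7_mul_eq_One using xy by blast
  \<comment> \<open>No factor mixes \<open>One\<close> and \<open>Elt_a\<close>: a fixed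
    \<open>y\<close> determines every \<open>x\<close> in \<open>X\<close>, and such an
    \<open>x\<close> then determines all of \<open>Y\<close>. This needs \<open>One\<close> and
    \<open>Elt_a\<close> to be distinct.\<close>
  moreover have "?XY = {Elt_a} \<longleftrightarrow> X = {One} \<and> Y = {Elt_a} \<or> X = {Elt_a} \<and> Y = {One}"
    unfolding balls s7_mul_eq_Elt_a using xy s7.distinct(6) by metis
  ultimately show ?thesis
    unfolding collapse_def by simp
qed

text \<open>A union of nonempty sets is a singleton only if both sets equal it. Nonemptiness
  matters: \<open>collapse {}\<close> is \<open>Zero\<close>, which is absorbing for addition,
  whereas the empty set is neutral for union.\<close>

lemma collapse_union:
  assumes "X \<noteq> {}" "Y \<noteq> {}"
  shows "collapse (X \<union> Y) = (if collapse X = collapse Y then collapse X else Zero)"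
  using assms by (auto simp: collapse_def Un_singleton_iff)

lemma collapse_hom: "collapse \<in> sring_hom (power_sring (mult_reduct S7)) S7"
  using collapse_mul collapse_union
  by (auto simp: sring_hom_def power_sring_def S7_def sgr.defs)

theorem mainTheorem7: "S7 \<in> variety (power_sring (mult_reduct S7))"
proof (rule hom_image_in_variety[OF _ ai_semiring_S7 collapse_hom])
  show "ai_semiring (power_sring (mult_reduct S7))"
    by (intro ai_semiring_power_sring semigroup_on_mult_reduct ai_semiring_S7)
  have "x \<in> collapse ` carrier (power_sring (mult_reduct S7))" for x
    \<comment> \<open>Singletons alone already reach every element of \<open>S7\<close>.\<close>
    by (rule image_eqI[of _ _ "{x}"])
      (cases x; simp add: collapse_def power_sring_def S7_def sgr.defs)+
  then show "collapse ` carrier (power_sring (mult_reduct S7)) = carrier S7"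
    by (auto simp: S7_def)
qed

end
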